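(* Let $r,D$ be positive integers and let $F:\mathbb{Z}^r\to\mathbb{Z}$ be periodic with period $D$ in each component, i.e. $F(q_1,\dots,q_j+D,\dots,q_r)=F(q_1,\dots,q_r)$ for all $j$ and all $(q_1,\dots,q_r)\in\mathbb{Z}^r$. Let $\xi\in\mathbb{C}$ satisfy $\xi^D=1$ (not necessarily primitive). For $n\ge0$ define $$S(n)=\sum_{q_1=0}^n\sum_{q_2=0}^{n-q_1}\cdots\sum_{q_r=0}^{n-q_1-\cdots-q_{r-1}} \binom{n}{q_1}\binom{n-q_1}{q_2}\cdots\binom{n-q_1-\cdots -q_{r-1}}{q_r}\xi^{F(q_1,\dots,q_r)}.$$ Then $$ S(n)=\frac{1}{D^r}\sum_{b_r=0}^{D-1}\cdots \sum_{b_1=0}^{D-1}\sum_{j_1=0}^{D-1}\cdots \sum_{j_r=0}^{D-1} \xi^{F(b_1,\dots,b_r)}\xi_D^{j_1b_r+\cdots+j_rb_1}\lambda_{j_1,\dots,j_r}^n,$$ where $\xi_D=\exp(2\pi i/D)$ and $\lambda_{j_1,\dots, j_r} = 1+\xi_D^{-j_1}+\xi_D^{-j_2}+\cdots+\xi_D^{-j_r}$. *)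

theory Defs
  imports Complex_Main
begin

text \<open>
  Tuples $(q_1, \dots, q_r)$ are lists of length \<open>r\<close>, with the component $q_k$ stored at
  position \<open>k - 1\<close>. A function on $\mathbf{Z}^r$ is a function on \<open>int list\<close> of which only the
  values at lists of length \<open>r\<close> matter.
\<close>

definition periodic_each :: "nat \<Rightarrow> nat \<Rightarrow> (int list \<Rightarrow> int) \<Rightarrow> bool" where
  "periodic_each r D F \<longleftrightarrow>
     (\<forall>q. length q = r \<longrightarrow> (\<forall>j<r. F (q[j := q ! j + int D]) = F q))"

text \<open>
  The iterated sum over $q_1 \in B()$, $q_2 \in B(q_1)$, \dots, $q_r \in B(q_1, \dots, q_{r-1})$
  of $f(q_1, \dots, q_r)$, with the sum over $q_1$ outermost: the range of each variable may
  depend on the variables before it.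
\<close>

primrec nested_sum ::
  "nat \<Rightarrow> (nat list \<Rightarrow> nat set) \<Rightarrow> (nat list \<Rightarrow> complex) \<Rightarrow> complex" where
  "nested_sum 0 B f = f []"
| "nested_sum (Suc r) B f =
     (\<Sum>q\<in>B []. nested_sum r (\<lambda>p. B (q # p)) (\<lambda>p. f (q # p)))"

text \<open>
  In the ranges below the subtraction on \<open>nat\<close> never truncates, because the earlier variables
  always have sum at most \<open>n\<close>. The exponent of \<open>\<xi>\<close> is an integer, possibly negative.
\<close>

definition S :: "nat \<Rightarrow> (int list \<Rightarrow> int) \<Rightarrow> complex \<Rightarrow> nat \<Rightarrow> complex" where
  "S r F \<xi> n =
     nested_sum r (\<lambda>p. {0..n - sum_list p})
       (\<lambda>q. (\<Prod>k<r. of_nat ((n - sum_list (take k q)) choose (q ! k)))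
             * \<xi> powi F (map int q))"

definition xi :: "nat \<Rightarrow> complex" where
  "xi D = exp (2 * of_real pi * \<i> / of_nat D)"

definition lam :: "nat \<Rightarrow> nat list \<Rightarrow> complex" where
  "lam D j = 1 + (\<Sum>k<length j. xi D powi (- int (j ! k)))"

definition tuples :: "nat \<Rightarrow> nat \<Rightarrow> nat list set" where
  "tuples r D = {b. length b = r \<and> set b \<subseteq> {0..<D}}"

end

(*
  The inner sum over the nested ranges is handled one variable at a time, by induction on r.
  Orthogonality of the characters j \<mapsto> xi_D^{j b} on Z/DZ replaces the value of a periodic function
  at q by the average over b, j < D of its value at b times xi_D^{j (b - q)}; the binomial theorem
  then sums binom(n, q) xi_D^{-j q} lambda^{n - q} to (lambda + xi_D^{-j})^n. This pairs j_k with
  b_k; the pairing of j_k with b_{r+1-k} follows because lambda is symmetric in the j_k.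
*)
theory Submission
  imports Defs
begin

lemma xi_power: "xi D ^ k = cis (2 * pi * real k / real D)"
proof -
  have "xi D = cis (2 * pi / real D)"
    by (simp add: xi_def cis_conv_exp mult_ac)
  then show ?thesis
    by (simp add: DeMoivre mult_ac)
qed

lemma xi_nonzero [simp]: "xi D \<noteq> 0"
  by (simp add: xi_def)

lemma xi_power_period: "D > 0 \<Longrightarrow> xi D ^ D = 1"
  by (simp add: xi_power)

lemma xi_power_mod: "D > 0 \<Longrightarrow> xi D ^ (q mod D) = xi D ^ q"
  using power_add[of "xi D" "D * (q div D)" "q mod D"] by (simp add: power_mult xi_power_period)

text \<open>The powers \<open>xi D ^ k\<close> with k < D enumerate the D-th roots of unity without
  repetition, so equality is decided on residues modulo D.\<close>

lemma xi_power_eq_iff: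
  assumes "D > 0" "b < D"
  shows "xi D ^ b = xi D ^ q \<longleftrightarrow> b = q mod D"
proof -
  have "inj_on (\<lambda>k. xi D ^ k) {..<D}"
    using bij_betw_roots_unity[OF assms(1)] by (simp add: bij_betw_def xi_power)
  then have "xi D ^ b = xi D ^ (q mod D) \<longleftrightarrow> b = q mod D"
    using assms by (auto simp: inj_on_eq_iff)
  then show ?thesis
    using assms by (simp add: xi_power_mod)
qed

text \<open>A geometric sum whose ratio z is a D-th root of unity: it vanishes unless z = 1. The
  character is written as a power of \<open>xi D powi (- int j)\<close>, the term that j contributes
  to \<open>lam\<close>.\<close>

lemma xi_orthogonality:
  assumes "D > 0" "b < D"
  shows "(\<Sum>j<D. xi D ^ (j * b) * (xi D powi (- int j)) ^ q) = (if b = q mod D then of_nat D else 0)"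
proof -
  define z where "z = xi D ^ b / xi D ^ q"
  have "xi D ^ (j * b) * (xi D powi (- int j)) ^ q = z ^ j" for j
    by (simp add: z_def power_int_minus power_mult_distrib divide_inverse power_inverse mult.commute
        flip: power_mult)
  moreover have "z = 1 \<longleftrightarrow> b = q mod D"
    using xi_power_eq_iff[OF assms] by (simp add: z_def)
  moreover have "z ^ D = 1"
  proof -
    have "(xi D ^ m) ^ D = 1" for m
      using assms by (metis mult.commute power_mult power_one xi_power_period)
    then show ?thesis
      by (simp add: z_def power_divide)
  qed
  ultimately show ?thesis
    by (simp add: sum_gp_strict)
qed

text \<open>Fourier inversion on Z/DZ. On the right, q occurs only as the exponent of a fixed
  number, which is what a binomial sum over q can absorb.\<close>

lemma periodic_sampling:
  fixes g :: "nat \<Rightarrow> complex"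
  assumes "D > 0" "g (q mod D) = g q"
  shows "g q = 1 / of_nat D *
    (\<Sum>b<D. \<Sum>j<D. g b * (xi D ^ (j * b) * (xi D powi (- int j)) ^ q))"
proof -
  have "(\<Sum>b<D. \<Sum>j<D. g b * (xi D ^ (j * b) * (xi D powi (- int j)) ^ q))
      = (\<Sum>b<D. if b = q mod D then g b * of_nat D else 0)"
    using assms(1) by (intro sum.cong) (auto simp: xi_orthogonality simp flip: sum_distrib_left)
  also have "\<dots> = g (q mod D) * of_nat D"
    using assms(1) by simp
  finally show ?thesis
    using assms by simp
qed

lemma nested_sum_cmult: "nested_sum r B (\<lambda>q. c * f q) = c * nested_sum r B f"
  by (induction r arbitrary: B f) (simp_all add: sum_distrib_left)

lemma tuples_0: "tuples 0 D = {[]}"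
  by (auto simp: tuples_def)

lemma sum_tuples_Suc:
  fixes h :: "nat list \<Rightarrow> complex"
  shows "(\<Sum>b\<in>tuples (Suc r) D. h b) = (\<Sum>b<D. \<Sum>p\<in>tuples r D. h (b # p))"
proof -
  have "(\<Sum>b\<in>tuples (Suc r) D. h b) = (\<Sum>(b, p)\<in>{..<D} \<times> tuples r D. h (b # p))"
    by (rule sum.reindex_bij_witness[where i = "\<lambda>(b, p). b # p" and j = "\<lambda>b. (hd b, tl b)"])
      (auto simp: tuples_def length_Suc_conv)
  then show ?thesis
    by (simp add: sum.cartesian_product)
qed

lemma sum_tuples_rev:
  fixes h :: "nat list \<Rightarrow> complex"
  shows "(\<Sum>j\<in>tuples r D. h (rev j)) = (\<Sum>j\<in>tuples r D. h j)"
  by (rule sum.reindex_bij_witness[where i = rev and j = rev]) (auto simp: tuples_def)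

lemma lam_Nil: "lam D [] = 1"
  by (simp add: lam_def)

lemma lam_Cons: "lam D (j # js) = xi D powi (- int j) + lam D js"
  by (simp add: lam_def sum.lessThan_Suc_shift del: sum.lessThan_Suc)

lemma lam_rev: "lam D (rev j) = lam D j"
proof -
  \<comment> \<open>A sum over the list itself, without indices, makes the symmetry in the entries
    visible.\<close>
  have "lam D j = 1 + (\<Sum>x\<leftarrow>j. xi D powi (- int x))" for j
    by (induction j) (simp_all add: lam_Nil lam_Cons)
  then show ?thesis
    by (simp add: sum_list_rev flip: rev_map)
qed

text \<open>Stated for an arbitrary g that depends only on residues, because fixing the outermost
  variable q turns g into \<open>\<lambda>p. g (q # p)\<close>, which is again of this kind, with n
  replaced by n - q.\<close>

lemma nested_sum_multinomial_periodic:
  fixes g :: "nat list \<Rightarrow> complex"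
  assumes "D > 0" and "\<And>q. length q = r \<Longrightarrow> g (map (\<lambda>x. x mod D) q) = g q"
  shows "nested_sum r (\<lambda>p. {0..n - sum_list p})
      (\<lambda>q. (\<Prod>k<r. of_nat ((n - sum_list (take k q)) choose (q ! k))) * g q) =
    1 / of_nat D ^ r * (\<Sum>b\<in>tuples r D. \<Sum>j\<in>tuples r D.
      g b * xi D ^ (\<Sum>k<r. j ! k * b ! k) * lam D j ^ n)"
  using assms(2)
proof (induction r arbitrary: n g)
  case 0
  show ?case by (simp add: tuples_0 lam_Nil)
next
  case (Suc r)
  let ?w = "\<lambda>j p. xi D ^ (\<Sum>k<r. j ! k * p ! k)"
  \<comment> \<open>Reducing only the tail, or only the head, leaves the residues of the whole tuple
    unchanged, so both sides agree with the fully reduced tuple.\<close>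
  have mod_tail: "g (q # map (\<lambda>x. x mod D) p) = g (q # p)" if "length p = r" for q p
    using Suc.prems[of "q # p"] Suc.prems[of "q # map (\<lambda>x. x mod D) p"] that
    by (simp add: comp_def)
  have mod_head: "g ((q mod D) # p) = g (q # p)" if "length p = r" for q p
    using Suc.prems[of "q # p"] Suc.prems[of "(q mod D) # p"] that by simp
  \<comment> \<open>The factor k = 0 is n choose q; the others are those of p for n - q, as n - (q +
    s) = (n - q) - s holds on \<open>nat\<close> even under truncation.\<close>
  have peel: "nested_sum r (\<lambda>p. {0..n - sum_list (q # p)})
      (\<lambda>p. (\<Prod>k<Suc r. of_nat ((n - sum_list (take k (q # p))) choose ((q # p) ! k))) * g (q # p))
    = of_nat (n choose q) * (1 / of_nat D ^ r * (\<Sum>p\<in>tuples r D. \<Sum>j\<in>tuples r D.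
        g (q # p) * ?w j p * lam D j ^ (n - q)))" for q
  proof -
    have "(\<lambda>p. {0..n - sum_list (q # p)}) = (\<lambda>p. {0..(n - q) - sum_list p})"
      by simp
    moreover have "(\<Prod>k<Suc r. of_nat ((n - sum_list (take k (q # p))) choose ((q # p) ! k))) * g (q # p)
      = of_nat (n choose q) *
        ((\<Prod>k<r. of_nat (((n - q) - sum_list (take k p)) choose (p ! k))) * g (q # p))" for p
      by (simp add: prod.lessThan_Suc_shift del: prod.lessThan_Suc)
    moreover note Suc.IH[of "\<lambda>p. g (q # p)" "n - q", OF mod_tail]
    ultimately show ?thesis
      by (simp only: nested_sum_cmult)
  qed
  \<comment> \<open>Only the head of g is sampled. The sums end in the order b, p, j, i, so that b,
    p and j, i can later merge into tuples of length \<open>Suc r\<close>.\<close>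
  have sampled: "(\<Sum>p\<in>tuples r D. \<Sum>i\<in>tuples r D. g (q # p) * ?w i p * lam D i ^ (n - q))
    = 1 / of_nat D * (\<Sum>b<D. \<Sum>p\<in>tuples r D. \<Sum>j<D. \<Sum>i\<in>tuples r D.
        g (b # p) * xi D ^ (j * b) * ?w i p *
        ((xi D powi (- int j)) ^ q * lam D i ^ (n - q)))" for q
  proof -
    have "(\<Sum>p\<in>tuples r D. \<Sum>i\<in>tuples r D. g (q # p) * ?w i p * lam D i ^ (n - q))
      = (\<Sum>p\<in>tuples r D. g (q # p) * (\<Sum>i\<in>tuples r D. ?w i p * lam D i ^ (n - q)))"
      by (simp add: sum_distrib_left mult.assoc)
    also have "\<dots> = (\<Sum>p\<in>tuples r D. 1 / of_nat D *
        (\<Sum>b<D. \<Sum>j<D. g (b # p) * (xi D ^ (j * b) * (xi D powi (- int j)) ^ q)) *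
        (\<Sum>i\<in>tuples r D. ?w i p * lam D i ^ (n - q)))"
    proof (rule sum.cong[OF refl])
      fix p assume "p \<in> tuples r D"
      then have "g ((q mod D) # p) = g (q # p)"
        by (intro mod_head) (simp add: tuples_def)
      from periodic_sampling[of D "\<lambda>q. g (q # p)", OF assms(1) this]
      show "g (q # p) * (\<Sum>i\<in>tuples r D. ?w i p * lam D i ^ (n - q)) = 1 / of_nat D *
        (\<Sum>b<D. \<Sum>j<D. g (b # p) * (xi D ^ (j * b) * (xi D powi (- int j)) ^ q)) *
        (\<Sum>i\<in>tuples r D. ?w i p * lam D i ^ (n - q))"
        by (rule arg_cong)
    qed
    also have "\<dots> = 1 / of_nat D * (\<Sum>p\<in>tuples r D.
        (\<Sum>b<D. \<Sum>j<D. g (b # p) * (xi D ^ (j * b) * (xi D powi (- int j)) ^ q)) *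
        (\<Sum>i\<in>tuples r D. ?w i p * lam D i ^ (n - q)))"
      by (simp only: mult.assoc sum_distrib_left[symmetric])
    also have "\<dots> = 1 / of_nat D * (\<Sum>p\<in>tuples r D. \<Sum>b<D. \<Sum>j<D.
        g (b # p) * (xi D ^ (j * b) * (xi D powi (- int j)) ^ q) *
        (\<Sum>i\<in>tuples r D. ?w i p * lam D i ^ (n - q)))"
      by (simp only: sum_distrib_right)
    also have "\<dots> = 1 / of_nat D * (\<Sum>p\<in>tuples r D. \<Sum>b<D. \<Sum>j<D. \<Sum>i\<in>tuples r D.
        g (b # p) * xi D ^ (j * b) * ?w i p *
        ((xi D powi (- int j)) ^ q * lam D i ^ (n - q)))"
      by (simp add: sum_distrib_left mult_ac)
    also have "\<dots> = 1 / of_nat D * (\<Sum>b<D. \<Sum>p\<in>tuples r D. \<Sum>j<D. \<Sum>i\<in>tuples r D.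
        g (b # p) * xi D ^ (j * b) * ?w i p *
        ((xi D powi (- int j)) ^ q * lam D i ^ (n - q)))"
      by (subst sum.swap) (rule refl)
    finally show ?thesis .
  qed
  have "nested_sum (Suc r) (\<lambda>p. {0..n - sum_list p})
      (\<lambda>q. (\<Prod>k<Suc r. of_nat ((n - sum_list (take k q)) choose (q ! k))) * g q)
    = (\<Sum>q\<le>n. of_nat (n choose q) * (1 / of_nat D ^ r * (1 / of_nat D *
        (\<Sum>b<D. \<Sum>p\<in>tuples r D. \<Sum>j<D. \<Sum>i\<in>tuples r D.
          g (b # p) * xi D ^ (j * b) * ?w i p *
          ((xi D powi (- int j)) ^ q * lam D i ^ (n - q))))))"
    unfolding nested_sum.simps peel sampled by (simp add: atLeast0AtMost)
  also have "\<dots> = 1 / of_nat D ^ Suc r * (\<Sum>q\<le>n.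
        \<Sum>b<D. \<Sum>p\<in>tuples r D. \<Sum>j<D. \<Sum>i\<in>tuples r D.
          g (b # p) * xi D ^ (j * b) * ?w i p *
          (of_nat (n choose q) * (xi D powi (- int j)) ^ q * lam D i ^ (n - q)))"
    by (simp add: sum_distrib_left mult_ac)
  \<comment> \<open>With the sum over q moved innermost, it is the binomial expansion of the n-th
    power.\<close>
  also have "\<dots> = 1 / of_nat D ^ Suc r * (\<Sum>b<D. \<Sum>p\<in>tuples r D. \<Sum>j<D. \<Sum>i\<in>tuples r D.
          g (b # p) * xi D ^ (j * b) * ?w i p * (xi D powi (- int j) + lam D i) ^ n)"
    unfolding binomial_ring sum_distrib_left[symmetric]
    by (simp only: sum.swap[of _ _ "{..n}"] sum_distrib_left)
  \<comment> \<open>The new head j supplies both the term k = 0 of the exponent and the new summand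
    of \<open>lam\<close>.\<close>
  also have "\<dots> = 1 / of_nat D ^ Suc r * (\<Sum>b\<in>tuples (Suc r) D. \<Sum>j\<in>tuples (Suc r) D.
      g b * xi D ^ (\<Sum>k<Suc r. j ! k * b ! k) * lam D j ^ n)"
    by (simp add: sum_tuples_Suc lam_Cons sum.lessThan_Suc_shift power_add mult.assoc
        del: sum.lessThan_Suc)
  finally show ?case .
qed

text \<open>Iterates the one-step shift at position \<open>length xs\<close>. Natural multiples
  suffice for passing from x mod D back to x.\<close>

lemma periodic_each_add_multiple:
  assumes "periodic_each r D F" "length xs + Suc (length ys) = r"
  shows "F (xs @ (x + int D * int k) # ys) = F (xs @ x # ys)"
proof (induction k)
  case (Suc k)
  have "F ((xs @ (x + int D * int k) # ys)[length xs := x + int D * int k + int D])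
      = F (xs @ (x + int D * int k) # ys)"
    using assms unfolding periodic_each_def
    by (metis length_append length_Cons nth_append_length less_add_Suc1 add_Suc_right)
  then show ?case
    using Suc by (simp add: algebra_simps)
qed simp

text \<open>The prefix \<open>xs\<close> collects the entries already reduced, so the induction on q
  changes one coordinate at a time.\<close>

lemma periodic_each_mod:
  assumes "periodic_each r D F" "length xs + length q = r"
  shows "F (xs @ map int (map (\<lambda>x. x mod D) q)) = F (xs @ map int q)"
  using assms(2)
proof (induction q arbitrary: xs)
  case (Cons x q)
  have "F (xs @ int (x mod D) # map int (map (\<lambda>x. x mod D) q)) = F (xs @ int (x mod D) # map int q)"
    using Cons.IH[of "xs @ [int (x mod D)]"] Cons.prems by simp
  also have "\<dots> = F (xs @ (int (x mod D) + int D * int (x div D)) # map int q)"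
    using assms(1) Cons.prems by (subst periodic_each_add_multiple[of r]) auto
  also have "int (x mod D) + int D * int (x div D) = int x"
    by (metis mod_mult_div_eq of_nat_add of_nat_mult)
  finally show ?case by simp
qed simp

theorem theorem4p4:
  fixes r D n :: nat and F :: "int list \<Rightarrow> int" and \<xi> :: complex
  assumes "r > 0" and "D > 0"
    and "periodic_each r D F"
    and "\<xi> ^ D = 1"
  shows "S r F \<xi> n =
    1 / of_nat D ^ r *
      (\<Sum>b\<in>tuples r D. \<Sum>j\<in>tuples r D.
         \<xi> powi F (map int b) * xi D ^ (\<Sum>k<r. j ! k * b ! (r - 1 - k)) * lam D j ^ n)"
proof -
  have "\<xi> powi F (map int (map (\<lambda>x. x mod D) q)) = \<xi> powi F (map int q)" if "length q = r" for q
    using periodic_each_mod[OF assms(3), of "[]" q] that by simp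
  then have "S r F \<xi> n = 1 / of_nat D ^ r * (\<Sum>b\<in>tuples r D. \<Sum>j\<in>tuples r D.
      \<xi> powi F (map int b) * xi D ^ (\<Sum>k<r. j ! k * b ! k) * lam D j ^ n)"
    unfolding S_def by (rule nested_sum_multinomial_periodic[OF assms(2)])
  \<comment> \<open>For each fixed b, substitute \<open>rev j\<close> for j: this permutes the
    tuples and preserves \<open>lam\<close>, and the index change k to r - 1 - k in the exponent
    moves the reversal from j to b.\<close>
  moreover have "(\<Sum>j\<in>tuples r D.
        \<xi> powi F (map int b) * xi D ^ (\<Sum>k<r. j ! k * b ! k) * lam D j ^ n)
    = (\<Sum>j\<in>tuples r D.
        \<xi> powi F (map int b) * xi D ^ (\<Sum>k<r. j ! k * b ! (r - 1 - k)) * lam D j ^ n)" for b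
  proof -
    have "(\<Sum>k<r. rev j ! k * b ! k) = (\<Sum>k<r. j ! k * b ! (r - 1 - k))" if "j \<in> tuples r D" for j
    proof -
      have "(\<Sum>k<r. rev j ! k * b ! k) = (\<Sum>k<r. rev j ! (r - Suc k) * b ! (r - Suc k))"
        by (rule sum.nat_diff_reindex[symmetric])
      also have "\<dots> = (\<Sum>k<r. j ! k * b ! (r - 1 - k))"
        using that by (intro sum.cong) (auto simp: tuples_def rev_nth Suc_diff_Suc)
      finally show ?thesis .
    qed
    then show ?thesis
      by (subst sum_tuples_rev[symmetric]) (simp add: lam_rev)
  qed
  ultimately show ?thesis
    by simp
qed

end
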